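(* Let $\zeta\in\overline{\mathbb{D}}$, $\phi(z)=\zeta z$ and $q\in(0,1)$. Then the $q$-Berezin range $\mathbf{Ber}_q(C_\phi)$ of the composition operator $C_\phi$ acting on $A^2(\mathbb{D})$ is convex if and only if $\zeta\in[-1,1]$.
   Context: $\mathbb{D}$ is the open unit disk; $A^2(\mathbb{D})$ is the Bergman space of holomorphic $f$ on $\mathbb{D}$ with $\int_{\mathbb{D}}|f|^2dA<\infty$, $dA$ being area measure normalized so that $\mathbb{D}$ has area $1$. Its normalized reproducing kernel is $\hat k_\lambda(z)=\frac{1-|\lambda|^2}{(1-\overline\lambda z)^2}$, $\lambda,z\in\mathbb{D}$. The composition operator is $C_\phi f=f\circ\phi$. For a bounded operator $T$ on $A^2(\mathbb{D})$, $\mathbf{Ber}_q(T)=\{\langle T\hat k_\lambda,\hat k_\mu\rangle:\lambda,\mu\in\mathbb{D},\ \langle\hat k_\lambda,\hat k_\mu\rangle=q\}$. *)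

theory Defs
  imports "HOL-Complex_Analysis.Complex_Analysis"
begin

(* Elements of A^2(D) are represented by functions on all of the complex plane whose values
   outside the open unit disk are irrelevant: neither membership, nor the inner product, nor
   composition with a self-map of the disk (on the disk) depends on them. *)
definition bergman_space :: "(complex \<Rightarrow> complex) set" where
  "bergman_space =
     {f. f holomorphic_on ball 0 1 \<and> set_integrable lborel (ball 0 1) (\<lambda>z. (cmod (f z))\<^sup>2)}"

(* Division by pi normalizes area so that the unit disk has area 1;
   the inner product is linear in the first argument. *)
definition bergman_inner :: "(complex \<Rightarrow> complex) \<Rightarrow> (complex \<Rightarrow> complex) \<Rightarrow> complex" where
  "bergman_inner f g = (LINT z:ball 0 1|lborel. f z * cnj (g z)) / of_real pi"

definition bergman_nkernel :: "complex \<Rightarrow> complex \<Rightarrow> complex" where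
  "bergman_nkernel l z = of_real (1 - (cmod l)\<^sup>2) / (1 - cnj l * z)\<^sup>2"

definition composition_op :: "(complex \<Rightarrow> complex) \<Rightarrow> (complex \<Rightarrow> complex) \<Rightarrow> (complex \<Rightarrow> complex)" where
  "composition_op \<phi> = (\<lambda>f\<in>bergman_space. f \<circ> \<phi>)"

definition q_berezin_range :: "complex \<Rightarrow> ((complex \<Rightarrow> complex) \<Rightarrow> (complex \<Rightarrow> complex)) \<Rightarrow> complex set" where
  "q_berezin_range q T =
     {bergman_inner (T (bergman_nkernel l)) (bergman_nkernel m) | l m.
        l \<in> ball 0 1 \<and> m \<in> ball 0 1 \<and> bergman_inner (bergman_nkernel l) (bergman_nkernel m) = q}"

lemma bergman_nkernel_in_bergman_space:
  assumes "l \<in> ball 0 1"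
  shows "bergman_nkernel l \<in> bergman_space"
proof -
  have nz: "1 - cnj l * z \<noteq> 0" if "z \<in> cball 0 1" for z
  proof
    assume "1 - cnj l * z = 0"
    then have "cmod (cnj l * z) = 1" by simp
    moreover have "cmod (cnj l * z) \<le> cmod l * 1"
      unfolding norm_mult complex_mod_cnj using that by (intro mult_left_mono) auto
    ultimately show False using assms by simp
  qed
  have "bergman_nkernel l holomorphic_on ball 0 1"
    unfolding bergman_nkernel_def using nz by (auto intro!: holomorphic_intros)
  moreover have "continuous_on (cball 0 1) (\<lambda>z. (cmod (bergman_nkernel l z))\<^sup>2)"
    unfolding bergman_nkernel_def using nz by (auto intro!: continuous_intros)
  then have "set_integrable lborel (cball 0 1) (\<lambda>z. (cmod (bergman_nkernel l z))\<^sup>2)"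
    unfolding set_integrable_def by (intro borel_integrable_compact) auto
  then have "set_integrable lborel (ball 0 1) (\<lambda>z. (cmod (bergman_nkernel l z))\<^sup>2)"
    by (rule set_integrable_subset) auto
  ultimately show ?thesis unfolding bergman_space_def by simp
qed

end

theory Submission
  imports Defs
begin

text \<open>
  Expanding the kernels in power series, with the monomials orthogonal by rotation invariance,
  gives \<open>\<langle>C\<^sub>\<phi> k\<^sub>\<lambda>, k\<^sub>\<mu>\<rangle> = (1 - \<bar>\<lambda>\<bar>\<^sup>2)(1 - \<bar>\<mu>\<bar>\<^sup>2) / (1 - \<zeta> w)\<^sup>2\<close>
  for the normalized kernels, where \<open>w = cnj \<lambda> * \<mu>\<close>. Since \<open>q\<close> is positive, the constraint
  \<open>\<langle>k\<^sub>\<lambda>, k\<^sub>\<mu>\<rangle> = q\<close> forces \<open>w\<close> to be real, and the range becomes the curve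
  \<open>q (1 - w)\<^sup>2 / (1 - \<zeta> w)\<^sup>2\<close> with \<open>w\<close> running through an interval \<open>[-r, 1)\<close>, \<open>r > 0\<close>.
  For real \<open>\<zeta>\<close> this is a real interval. For non-real \<open>\<zeta>\<close> the curve meets the real axis only
  at \<open>q\<close> (where \<open>w = 0\<close>), and positive and negative \<open>w\<close> lie on opposite sides of it. In a convex
  range every chord between the two sides would therefore pass through \<open>q\<close>; letting \<open>w\<close>
  tend to \<open>1\<close>, where the curve tends to \<open>0\<close>, puts every point with \<open>w < 0\<close> on the line through
  \<open>0\<close> and \<open>q\<close>, although these points are not real.
\<close>


section \<open>Rotation invariance of area measure on the complex plane\<close>

definition complex_of_vec :: "real^2 \<Rightarrow> complex" where
  "complex_of_vec v = Complex (v $ 1) (v $ 2)"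

definition vec_of_complex :: "complex \<Rightarrow> real^2" where
  "vec_of_complex z = vector [Re z, Im z]"

lemma complex_of_vec_inverse [simp]:
  "complex_of_vec (vec_of_complex z) = z" "vec_of_complex (complex_of_vec v) = v"
  by (auto simp: complex_of_vec_def vec_of_complex_def complex_eq_iff vec_eq_iff forall_2)

lemma measurable_complex_of_vec [measurable]: "complex_of_vec \<in> borel_measurable borel"
  unfolding complex_of_vec_def Complex_eq by measurable

lemma prod_Basis_vec_2:
  fixes f :: "real^2 \<Rightarrow> real"
  shows "(\<Prod>b\<in>Basis. f b) = f (axis 1 1) * f (axis 2 1)"
proof -
  have B: "(Basis :: (real^2) set) = {axis 1 1, axis 2 1}"
    by (auto simp: Basis_vec_def UNIV_2)
  show ?thesis unfolding B by (subst prod.insert) (auto simp: axis_eq_axis)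
qed

text \<open>Both measures give every box the product of its side lengths. This moves area from the
  complex plane to \<open>real^2\<close>, where orthogonal maps are known to preserve
  measure.\<close>

lemma lborel_complex_eq_distr_vec:
  "(lborel :: complex measure) = distr lborel borel complex_of_vec"
proof (rule lborel_eqI)
  fix l u :: complex
  assume le: "\<And>b. b \<in> Basis \<Longrightarrow> l \<bullet> b \<le> u \<bullet> b"
  have vim: "complex_of_vec -` box l u = box (vec_of_complex l) (vec_of_complex u)"
    by (auto simp: complex_of_vec_def vec_of_complex_def mem_box_cart mem_box Basis_complex_def
        forall_2)
  have "vec_of_complex l \<bullet> b \<le> vec_of_complex u \<bullet> b" if "b \<in> Basis" for b
    using that le[of 1] le[of \<i>]
    by (auto simp: Basis_vec_def inner_axis vec_of_complex_def Basis_complex_def UNIV_2)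
  then show "emeasure (distr lborel borel complex_of_vec) (box l u) = (\<Prod>b\<in>Basis. (u - l) \<bullet> b)"
    by (simp add: emeasure_distr vim emeasure_lborel_box prod_Basis_vec_2 inner_axis)
      (simp add: Basis_complex_def vec_of_complex_def)
qed simp

lemma orthogonal_transformation_complex_mult:
  assumes "cmod c = 1"
  shows "orthogonal_transformation (\<lambda>v. vec_of_complex (c * complex_of_vec v))"
  unfolding orthogonal_transformation_def
proof (intro conjI allI)
  show "linear (\<lambda>v. vec_of_complex (c * complex_of_vec v))"
    by (rule linearI) (auto simp: vec_of_complex_def complex_of_vec_def vec_eq_iff forall_2 algebra_simps)
  have c: "Re c * Re c + Im c * Im c = 1"
    using assms cmod_power2[of c] by (simp add: power2_eq_square)
  fix v w :: "real^2"
  have "vec_of_complex (c * complex_of_vec v) \<bullet> vec_of_complex (c * complex_of_vec w)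
        = (Re c * Re c + Im c * Im c) * (v \<bullet> w)"
    by (simp add: vec_of_complex_def complex_of_vec_def inner_vec_def sum_2 algebra_simps)
  then show "vec_of_complex (c * complex_of_vec v) \<bullet> vec_of_complex (c * complex_of_vec w) = v \<bullet> w"
    by (simp add: c)
qed

text \<open>Agreement on boxes suffices. The preimage of a box under multiplication by
  \<open>c\<close> is, seen in \<open>real^2\<close>, an orthogonal image of that box.\<close>

lemma lborel_distr_rotation:
  assumes c: "cmod c = 1"
  shows "distr lborel borel ((*) c) = (lborel :: complex measure)"
proof (rule lborel_eqI [symmetric])
  fix l u :: complex
  assume le: "\<And>b. b \<in> Basis \<Longrightarrow> l \<bullet> b \<le> u \<bullet> b"
  let ?S = "complex_of_vec -` box l u" and ?R = "\<lambda>v. vec_of_complex (cnj c * complex_of_vec v)"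
  have S: "?S \<in> sets borel"
    using measurable_sets[OF measurable_complex_of_vec, of "box l u"] by simp
  have vS: "emeasure lborel ?S = emeasure lborel (box l u)"
    by (subst lborel_complex_eq_distr_vec) (simp add: emeasure_distr)
  have cc: "c * cnj c = 1" "cnj c * c = 1"
    using c by (simp_all add: complex_norm_square [symmetric] mult.commute)
  \<comment> \<open>Since \<open>c * cnj c = 1\<close>, pulling back along \<open>c\<close> is the
    same as pushing forward along \<open>cnj c\<close>. This gives the image form to which
    orthogonal invariance applies.\<close>
  have im: "complex_of_vec -` ((*) c -` box l u) = ?R ` ?S"
  proof (intro equalityI subsetI)
    fix v assume "v \<in> complex_of_vec -` ((*) c -` box l u)"
    then show "v \<in> ?R ` ?S"
      by (intro image_eqI[of _ _ "vec_of_complex (c * complex_of_vec v)"])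
        (auto simp: cc mult.assoc[symmetric])
  next
    fix v assume "v \<in> ?R ` ?S"
    then show "v \<in> complex_of_vec -` ((*) c -` box l u)"
      by (auto simp: cc mult.assoc[symmetric])
  qed
  have lm: "?S \<in> lmeasurable"
    using S vS by (auto simp: fmeasurable_def emeasure_lborel_box_eq less_top[symmetric])
  have ot: "orthogonal_transformation ?R"
    by (rule orthogonal_transformation_complex_mult) (simp add: c)
  have RS: "?R ` ?S \<in> sets borel"
    unfolding im[symmetric]
    using measurable_sets[OF measurable_complex_of_vec, of "(*) c -` box l u"]
      measurable_sets[of "(*) c" borel borel "box l u"] by simp
  have "emeasure (distr lborel borel ((*) c)) (box l u) = emeasure lborel ((*) c -` box l u)"
    by (simp add: emeasure_distr)
  also have "\<dots> = emeasure lborel (?R ` ?S)"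
    using measurable_sets[of "(*) c" borel borel "box l u"]
    by (subst lborel_complex_eq_distr_vec) (simp add: emeasure_distr im)
  \<comment> \<open>Invariance under orthogonal maps concerns Lebesgue measurable sets of finite
    measure, hence the passage to the completion and back.\<close>
  also have "\<dots> = emeasure lebesgue (?R ` ?S)"
    using RS by simp
  also have "\<dots> = emeasure lebesgue ?S"
    using measurable_orthogonal_image[OF ot lm] measure_orthogonal_image[OF ot lm] lm
    by (simp add: emeasure_eq_measure2)
  also have "\<dots> = emeasure lborel (box l u)"
    using S vS by simp
  also have "\<dots> = (\<Prod>b\<in>Basis. (u - l) \<bullet> b)"
    by (rule emeasure_lborel_box) (use le in auto)
  finally show "emeasure (distr lborel borel ((*) c)) (box l u) = (\<Prod>b\<in>Basis. (u - l) \<bullet> b)" .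
qed simp

section \<open>Integrals of monomials over the unit disk\<close>

lemma emeasure_ball_complex: "r \<ge> 0 \<Longrightarrow> emeasure lborel (ball (c::complex) r) = ennreal (pi * r\<^sup>2)"
  by (simp add: emeasure_ball unit_ball_vol_2)

lemma emeasure_cball_complex: "r \<ge> 0 \<Longrightarrow> emeasure lborel (cball (c::complex) r) = ennreal (pi * r\<^sup>2)"
  by (simp add: emeasure_cball unit_ball_vol_2)

text \<open>The annulus \<open>x < |z|^2 < 1\<close> has area \<open>pi * (1 - x)\<close>, so the
  squared modulus of a point of the disk is uniformly distributed up to the factor
  \<open>pi\<close>. This replaces polar coordinates: radial integrals become integrals over
  \<open>{0..1}\<close>. Finite measures on the line are compared through their tails
  \<open>{x<..}\<close>.\<close>

lemma distr_norm_power2_ball: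
  "distr (density lborel (indicator (ball (0::complex) 1))) borel (\<lambda>z. (cmod z)\<^sup>2)
     = density lborel (\<lambda>t. ennreal (pi * indicator {0..1} t))" (is "?M = ?N")
proof (rule measure_eqI_lessThan)
  have M: "emeasure ?M {x<..} = ennreal (pi * (if x < 0 then 1 else if x < 1 then 1 - x else 0))" for x
  proof -
    have "emeasure ?M {x<..} = emeasure (density lborel (indicator (ball (0::complex) 1))) {z. x < (cmod z)\<^sup>2}"
      by (subst emeasure_distr) (auto intro!: arg_cong2[where f=emeasure])
    also have "\<dots> = (\<integral>\<^sup>+z. indicator (ball 0 1) z * indicator {z. x < (cmod z)\<^sup>2} z \<partial>lborel)"
      by (subst emeasure_density) (auto intro!: borel_measurable_indicator)
    also have "\<dots> = (\<integral>\<^sup>+z. indicator (ball 0 1 \<inter> {z::complex. x < (cmod z)\<^sup>2}) z \<partial>lborel)"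
      by (intro nn_integral_cong) (auto simp: indicator_def)
    also have "\<dots> = emeasure lborel (ball 0 1 \<inter> {z::complex. x < (cmod z)\<^sup>2})"
      by (subst nn_integral_indicator) auto
    also have "\<dots> = ennreal (pi * (if x < 0 then 1 else if x < 1 then 1 - x else 0))"
    proof -
      consider "x < 0" | "0 \<le> x" "x < 1" | "x \<ge> 1" by linarith
      then show ?thesis
      proof cases
        case 1
        then have "x < (cmod z)\<^sup>2" for z :: complex
          using zero_le_power2[of "cmod z"] by linarith
        then have "ball 0 1 \<inter> {z::complex. x < (cmod z)\<^sup>2} = ball 0 1"
          by auto
        then show ?thesis using 1 by (simp add: emeasure_ball_complex)
      next
        case 2
        have sqrt_iff: "(x < (cmod z)\<^sup>2) \<longleftrightarrow> sqrt x < cmod z" for z :: complex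
          unfolding real_sqrt_less_iff [of x, symmetric] real_sqrt_abs abs_norm_cancel ..
        have "{z::complex. x < (cmod z)\<^sup>2} = - cball 0 (sqrt x)"
          by (rule set_eqI) (simp only: mem_Collect_eq Compl_iff mem_cball dist_0_norm not_le sqrt_iff)
        then have "ball 0 1 \<inter> {z::complex. x < (cmod z)\<^sup>2} = ball 0 1 - cball 0 (sqrt x)"
          by (simp only: Diff_eq)
        moreover have "cball 0 (sqrt x) \<subseteq> ball (0::complex) 1"
          using 2 by (simp add: cball_subset_ball_iff)
        ultimately have "emeasure lborel (ball 0 1 \<inter> {z::complex. x < (cmod z)\<^sup>2})
            = ennreal (pi * 1\<^sup>2) - ennreal (pi * (sqrt x)\<^sup>2)"
          using 2 by (simp add: emeasure_Diff emeasure_cball_complex emeasure_ball_complex)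
        then show ?thesis using 2 by (simp add: ennreal_minus algebra_simps)
      next
        case 3
        have "ball 0 1 \<inter> {z::complex. x < (cmod z)\<^sup>2} = {}"
        proof -
          have "\<not> x < (cmod z)\<^sup>2" if "cmod z < 1" for z :: complex
            using 3 power_le_one[of "cmod z" 2] that by simp
          then show ?thesis by auto
        qed
        then show ?thesis using 3 by simp
      qed
    qed
    finally show ?thesis .
  qed
  show "emeasure ?M {x<..} < \<infinity>" for x by (simp add: M)
  show "emeasure ?M {x<..} = emeasure ?N {x<..}" for x
  proof -
    have "emeasure ?N {x<..} = (\<integral>\<^sup>+t. ennreal pi * indicator ({0..1} \<inter> {x<..}) t \<partial>lborel)"
      by (subst emeasure_density) (auto intro!: nn_integral_cong simp: indicator_def)
    also have "\<dots> = ennreal pi * emeasure lborel ({0..1} \<inter> {x<..})"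
      by (subst nn_integral_cmult_indicator) auto
    also have "{0..1} \<inter> {x<..} = (if x < 0 then {0..1} else {x<..1})"
      by auto
    finally show ?thesis unfolding M by (auto simp: ennreal_mult[symmetric])
  qed
qed simp_all

lemma set_lebesgue_integral_rotation:
  fixes f :: "complex \<Rightarrow> complex"
  assumes "cmod c = 1" and [measurable]: "f \<in> borel_measurable borel"
  shows "(LINT z:ball 0 1|lborel. f (c * z)) = (LINT z:ball 0 1|lborel. f z)"
proof -
  have "(LINT z:ball 0 1|lborel. f z) = (LINT z:ball 0 1|distr lborel borel ((*) c). f z)"
    by (simp add: lborel_distr_rotation assms)
  also have "\<dots> = (LINT z|lborel. indicator (ball 0 1) (c * z) *\<^sub>R f (c * z))"
    unfolding set_lebesgue_integral_def
    by (rule integral_distr) (auto intro!: borel_measurable_scaleR borel_measurable_indicator)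
  also have "\<dots> = (LINT z:ball 0 1|lborel. f (c * z))"
    unfolding set_lebesgue_integral_def
    by (rule Bochner_Integration.integral_cong) (auto simp: indicator_def norm_mult assms)
  finally show ?thesis ..
qed

lemma integral_norm_power2_power_ball:
  "(LINT z:ball (0::complex) 1|lborel. ((cmod z)\<^sup>2) ^ n) = pi / Suc n"
proof -
  have "(LINT z:ball (0::complex) 1|lborel. ((cmod z)\<^sup>2) ^ n)
      = (LINT z|density lborel (\<lambda>z. ennreal (indicator (ball (0::complex) 1) z)). ((cmod z)\<^sup>2) ^ n)"
    unfolding set_lebesgue_integral_def
    by (subst integral_density) (auto intro!: borel_measurable_indicator)
  also have "\<dots> = (LINT t|distr (density lborel (indicator (ball (0::complex) 1))) borel (\<lambda>z. (cmod z)\<^sup>2). t ^ n)"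
    by (subst integral_distr) (auto simp: ennreal_indicator)
  also have "\<dots> = pi * (LINT t|lborel. t ^ n * indicator {0..1} t)"
    unfolding distr_norm_power2_ball
    by (subst integral_density) (auto simp: mult_ac)
  also have "\<dots> = pi / Suc n"
    by (subst integral_power) (auto simp: field_simps)
  finally show ?thesis .
qed

text \<open>On the diagonal the integrand is the radial function \<open>|z|^(2n)\<close>. Off the
  diagonal a suitable rotation reverses the sign of the integrand but preserves the
  integral.\<close>

lemma integral_monomials_ball:
  "(LINT z:ball 0 1|lborel. z ^ n * cnj z ^ m) = (if n = m then of_real (pi / Suc n) else 0)"
proof (cases "n = m")
  case True
  have "(LINT z:ball 0 1|lborel. z ^ n * cnj z ^ m)
      = (LINT z:ball 0 1|lborel. complex_of_real (((cmod z)\<^sup>2) ^ n))"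
    unfolding True power_mult_distrib [symmetric] complex_norm_square [symmetric] of_real_power ..
  also have "\<dots> = of_real (LINT z:ball (0::complex) 1|lborel. ((cmod z)\<^sup>2) ^ n)"
    unfolding set_lebesgue_integral_def
    by (subst integral_complex_of_real [symmetric]) (simp add: scaleR_conv_of_real)
  finally show ?thesis using True by (simp add: integral_norm_power2_power_ball)
next
  case False
  \<comment> \<open>The rotation multiplies the integrand by \<open>c ^ n * cnj c ^ m\<close>, whose
    argument is \<open>n - m\<close> times that of \<open>c\<close>; this angle makes it
    \<open>pi\<close>, so the factor is -1.\<close>
  define c where "c = cis (pi / (real n - real m))"
  have "c ^ n * cnj c ^ m = cis (pi / (real n - real m) * (real n - real m))"
    by (simp add: c_def cis_cnj Complex.DeMoivre cis_mult algebra_simps diff_divide_distrib)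
  then have c: "c ^ n * cnj c ^ m = -1" using False by simp
  let ?I = "(LINT z:ball 0 1|lborel. z ^ n * cnj z ^ m)"
  have "?I = (LINT z:ball 0 1|lborel. (c * z) ^ n * cnj (c * z) ^ m)"
    by (rule set_lebesgue_integral_rotation [symmetric])
      (auto simp: c_def intro!: borel_measurable_continuous_onI continuous_intros)
  also have "\<dots> = (LINT z:ball 0 1|lborel. (c ^ n * cnj c ^ m) * (z ^ n * cnj z ^ m))"
    by (simp add: power_mult_distrib mult_ac)
  also have "\<dots> = - ?I" unfolding c by (simp add: set_lebesgue_integral_def)
  finally show ?thesis using False by simp
qed

section \<open>Inner products of kernels by power series\<close>

lemma sums_integral_power_series_ball:
  fixes f g :: "complex \<Rightarrow> complex"
  assumes g: "set_integrable lborel (ball 0 1) g"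
    and c: "summable (\<lambda>n. cmod (c n))"
    and f: "\<And>z. z \<in> ball 0 1 \<Longrightarrow> (\<lambda>n. c n * z ^ n) sums f z"
  shows "(\<lambda>n. c n * (LINT z:ball 0 1|lborel. z ^ n * g z)) sums (LINT z:ball 0 1|lborel. f z * g z)"
proof -
  \<comment> \<open>Extending \<open>g\<close> by zero makes
    \<open>|z ^ n * G z| \<le> |G z|\<close> valid on the whole plane. The \<open>n\<close>-th term
    is then bounded by \<open>|c n| * |G z|\<close>, a summable factor times an integrable one,
    which justifies termwise integration.\<close>
  define G where "G = (\<lambda>z. indicator (ball 0 1) z *\<^sub>R g z)"
  let ?F = "\<lambda>n z. c n * (z ^ n * G z)"
  have le: "cmod (z ^ n * G z) \<le> cmod (G z)" for n z
  proof (cases "z \<in> ball 0 1")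
    case True
    then have "cmod z ^ n \<le> 1" by (intro power_le_one) auto
    then show ?thesis
      using mult_right_mono[of "cmod z ^ n" 1 "cmod (G z)"] by (simp add: norm_mult norm_power)
  qed (simp add: G_def)
  have G: "integrable lborel G" using g by (simp add: set_integrable_def G_def)
  have G_meas: "G \<in> borel_measurable borel" using borel_measurable_integrable[OF G] by simp
  have int: "integrable lborel (\<lambda>z. z ^ n * G z)" for n
    by (rule Bochner_Integration.integrable_bound[OF G])
      (use G_meas le in auto)
  have "(\<lambda>n. LINT z|lborel. ?F n z) sums (LINT z|lborel. (\<Sum>n. ?F n z))"
  proof (rule sums_integral)
    show "integrable lborel (?F n)" for n
      using int by (intro integrable_mult_right)
    have "cmod (?F n z) \<le> cmod (c n) * cmod (G z)" for n z
      using le mult_left_mono by (simp only: norm_mult [of "c n"]) (simp add: mult_left_mono)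
    then have "summable (\<lambda>n. cmod (?F n z))" for z
      by (intro summable_comparison_test'[OF summable_mult2[OF c, of "cmod (G z)"], of 0])
        (simp only: real_norm_def abs_norm_cancel)
    then show "AE z in lborel. summable (\<lambda>n. cmod (?F n z))" by (intro AE_I2)
    have "(LINT z|lborel. cmod (?F n z)) \<le> cmod (c n) * (LINT z|lborel. cmod (G z))" for n
    proof -
      have "(LINT z|lborel. cmod (?F n z)) = cmod (c n) * (LINT z|lborel. cmod (z ^ n * G z))"
        by (simp only: norm_mult [of "c n"] integral_mult_right_zero)
      also have "\<dots> \<le> cmod (c n) * (LINT z|lborel. cmod (G z))"
        by (intro mult_left_mono integral_mono integrable_norm int G le norm_ge_zero)
      finally show ?thesis .
    qed
    moreover have "(LINT z|lborel. cmod (?F n z)) \<ge> 0" for n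
      by (rule integral_nonneg_AE) (intro AE_I2 norm_ge_zero)
    ultimately show "summable (\<lambda>n. LINT z|lborel. cmod (?F n z))"
      by (intro summable_comparison_test'[OF summable_mult2[OF c, of "LINT z|lborel. cmod (G z)"], of 0])
        (simp only: real_norm_def abs_of_nonneg)
  qed
  moreover have "(\<lambda>n. LINT z|lborel. ?F n z) = (\<lambda>n. c n * (LINT z:ball 0 1|lborel. z ^ n * g z))"
    unfolding set_lebesgue_integral_def G_def mult_scaleR_right [symmetric]
    by (intro ext integral_mult_right_zero)
  moreover have "(LINT z|lborel. (\<Sum>n. ?F n z)) = (LINT z:ball 0 1|lborel. f z * g z)"
    unfolding set_lebesgue_integral_def
  proof (rule Bochner_Integration.integral_cong)
    fix z show "(\<Sum>n. ?F n z) = indicator (ball 0 1) z *\<^sub>R (f z * g z)"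
    proof (cases "z \<in> ball 0 1")
      case True
      then show ?thesis using sums_unique[OF sums_mult2[OF f[OF True], of "g z"]]
        by (simp add: G_def mult.assoc)
    qed (simp add: G_def)
  qed simp
  ultimately show ?thesis by simp
qed

lemma summable_geometric_deriv_norm:
  fixes a :: complex
  assumes "cmod a < 1"
  shows "summable (\<lambda>n. cmod (of_nat (Suc n) * a ^ n))"
  using sums_summable[OF geometric_deriv_sums[of "cmod a"]] assms
  by (simp add: norm_mult norm_power del: of_nat_Suc)

lemma geometric_deriv_sums_scaled:
  fixes a :: complex
  assumes "cmod a < 1" "z \<in> ball 0 1"
  shows "(\<lambda>n. of_nat (Suc n) * a ^ n * z ^ n) sums (1 / (1 - a * z)\<^sup>2)"
proof -
  have "cmod (a * z) < 1"
    using assms mult_strict_mono[of "cmod a" 1 "cmod z" 1] by (simp add: norm_mult)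
  then show ?thesis using geometric_deriv_sums[of "a * z"] by (simp add: power_mult_distrib mult_ac)
qed

lemma set_integrable_ball_continuous:
  fixes g :: "complex \<Rightarrow> complex"
  assumes "continuous_on (cball 0 1) g"
  shows "set_integrable lborel (ball 0 1) g"
proof -
  have "set_integrable lborel (cball 0 1) g"
    unfolding set_integrable_def by (intro borel_integrable_compact assms) auto
  then show ?thesis by (rule set_integrable_subset) auto
qed

lemma one_minus_mult_nonzero:
  fixes a z :: complex
  assumes "cmod a < 1" "cmod z \<le> 1"
  shows "1 - a * z \<noteq> 0"
proof
  assume "1 - a * z = 0"
  then have "cmod a * cmod z = 1" by (metis eq_iff_diff_eq_0 norm_mult norm_one)
  then show False using assms mult_left_mono[of "cmod z" 1 "cmod a"] by simp
qed

text \<open>Both factors expand with coefficients \<open>n + 1\<close> times a power. Orthogonality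
  leaves one diagonal sum, in which the weight \<open>pi / (n + 1)\<close> cancels one of the two
  factors \<open>n + 1\<close>; the rest is again the differentiated geometric series.\<close>

lemma integral_kernel_product_ball:
  fixes a b :: complex
  assumes a: "cmod a < 1" and b: "cmod b < 1"
  shows "(LINT z:ball 0 1|lborel. 1 / (1 - a * z)\<^sup>2 * cnj (1 / (1 - b * z)\<^sup>2)) = of_real pi / (1 - a * cnj b)\<^sup>2"
proof -
  define k where "k = (\<lambda>b z :: complex. 1 / (1 - b * z)\<^sup>2)"
  have k_cont: "continuous_on (cball 0 1) (k b)"
    unfolding k_def by (intro continuous_intros) (use one_minus_mult_nonzero[OF b] in auto)
  have k_sums: "(\<lambda>n. of_nat (Suc n) * b ^ n * z ^ n) sums k b z" if "cmod b < 1" "z \<in> ball 0 1" for b z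
    unfolding k_def using geometric_deriv_sums_scaled[OF that] .
  \<comment> \<open>Up to the factor \<open>pi\<close>, this is the reproducing property for the
    monomial \<open>z ^ n\<close> at the point \<open>cnj b\<close>. It is obtained by expanding
    \<open>k b\<close> against \<open>cnj z ^ n\<close> and then conjugating.\<close>
  have coeff: "(LINT z:ball 0 1|lborel. z ^ n * cnj (k b z)) = of_real pi * cnj b ^ n" for n
  proof -
    have "(\<lambda>m. (of_nat (Suc m) * b ^ m) * (LINT z:ball 0 1|lborel. z ^ m * cnj z ^ n))
        sums (LINT z:ball 0 1|lborel. k b z * cnj z ^ n)"
      by (rule sums_integral_power_series_ball)
        (use k_sums[OF b] summable_geometric_deriv_norm[OF b] in
          \<open>auto intro!: set_integrable_ball_continuous continuous_intros\<close>)
    also have "(\<lambda>m. (of_nat (Suc m) * b ^ m) * (LINT z:ball 0 1|lborel. z ^ m * cnj z ^ n))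
        = (\<lambda>m. if m = n then of_real pi * b ^ n else 0)"
      by (auto simp: integral_monomials_ball fun_eq_iff field_simps simp del: of_nat_Suc)
    finally have "(LINT z:ball 0 1|lborel. k b z * cnj z ^ n) = of_real pi * b ^ n"
      using sums_single[of n "\<lambda>_. of_real pi * b ^ n"] sums_unique2 by blast
    moreover have "(LINT z:ball 0 1|lborel. z ^ n * cnj (k b z)) = cnj (LINT z:ball 0 1|lborel. k b z * cnj z ^ n)"
      unfolding set_lebesgue_integral_def Bochner_Integration.integral_cnj [symmetric]
      by (rule Bochner_Integration.integral_cong) (simp_all add: complex_cnj_scaleR mult.commute)
    ultimately show ?thesis by simp
  qed
  have "(\<lambda>n. (of_nat (Suc n) * a ^ n) * (LINT z:ball 0 1|lborel. z ^ n * cnj (k b z)))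
      sums (LINT z:ball 0 1|lborel. k a z * cnj (k b z))"
    by (rule sums_integral_power_series_ball)
      (use k_sums[OF a] summable_geometric_deriv_norm[OF a] k_cont in
        \<open>auto intro!: set_integrable_ball_continuous continuous_intros\<close>)
  moreover have "(\<lambda>n. of_real pi * (of_nat (Suc n) * a ^ n * cnj b ^ n)) sums (of_real pi * (1 / (1 - a * cnj b)\<^sup>2))"
    by (intro sums_mult geometric_deriv_sums_scaled a) (use b in auto)
  ultimately have "(LINT z:ball 0 1|lborel. k a z * cnj (k b z)) = of_real pi * (1 / (1 - a * cnj b)\<^sup>2)"
    unfolding coeff by (simp add: sums_iff mult_ac del: of_nat_Suc)
  then show ?thesis by (simp add: k_def)
qed

text \<open>Dilating the argument only replaces \<open>cnj l\<close> by
  \<open>cnj l * \<zeta>\<close> in the denominator, and this still has modulus below 1 because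
  \<open>|l| < 1\<close>.\<close>

lemma bergman_inner_dilated_nkernel:
  assumes "l \<in> ball 0 1" "m \<in> ball 0 1" "cmod \<zeta> \<le> 1"
  shows "bergman_inner (bergman_nkernel l \<circ> (*) \<zeta>) (bergman_nkernel m)
     = of_real ((1 - (cmod l)\<^sup>2) * (1 - (cmod m)\<^sup>2)) / (1 - \<zeta> * (cnj l * m))\<^sup>2"
proof -
  have a: "cmod (cnj l * \<zeta>) < 1"
    using assms mult_left_mono[of "cmod \<zeta>" 1 "cmod l"] by (simp add: norm_mult)
  have b: "cmod (cnj m) < 1" using assms by simp
  let ?c = "complex_of_real ((1 - (cmod l)\<^sup>2) * (1 - (cmod m)\<^sup>2))"
  have "bergman_inner (bergman_nkernel l \<circ> (*) \<zeta>) (bergman_nkernel m)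
    = (LINT z:ball 0 1|lborel. ?c * (1 / (1 - (cnj l * \<zeta>) * z)\<^sup>2 * cnj (1 / (1 - cnj m * z)\<^sup>2))) / of_real pi"
    unfolding bergman_inner_def bergman_nkernel_def o_def by (simp add: mult_ac)
  also have "\<dots> = ?c * (of_real pi / (1 - cnj l * \<zeta> * cnj (cnj m))\<^sup>2) / of_real pi"
    by (subst integral_kernel_product_ball[OF a b, symmetric]) (simp only: set_integral_mult_right)
  finally show ?thesis by (simp add: mult_ac)
qed


section \<open>The range as a curve in one real parameter\<close>

lemma composition_op_nkernel:
  assumes "l \<in> ball 0 1"
  shows "composition_op \<phi> (bergman_nkernel l) = bergman_nkernel l \<circ> \<phi>"
  using bergman_nkernel_in_bergman_space[OF assms] by (simp add: composition_op_def)

lemma bergman_inner_nkernel: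
  assumes "l \<in> ball 0 1" "m \<in> ball 0 1"
  shows "bergman_inner (bergman_nkernel l) (bergman_nkernel m)
     = of_real ((1 - (cmod l)\<^sup>2) * (1 - (cmod m)\<^sup>2)) / (1 - cnj l * m)\<^sup>2"
  using bergman_inner_dilated_nkernel[OF assms, of 1] by (simp add: o_def)

text \<open>The values that \<open>cnj l * m\<close> takes under the constraint. For
  \<open>0 < q < 1\<close> this is the interval from \<open>-(1 - sqrt q) / (1 + sqrt q)\<close>,
  included, to 1, excluded.\<close>

definition berezin_parameters :: "real \<Rightarrow> real set" where
  "berezin_parameters q = {w. -1 < w \<and> w < 1 \<and> sqrt q * (1 - w) \<le> 1 - \<bar>w\<bar>}"

lemma berezin_parameters_iff:
  assumes "q \<ge> 0" "-1 < w" "w < 1"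
  shows "w \<in> berezin_parameters q \<longleftrightarrow> q * (1 - w)\<^sup>2 \<le> (1 - \<bar>w\<bar>)\<^sup>2"
proof -
  have "sqrt q * (1 - w) \<le> 1 - \<bar>w\<bar> \<longleftrightarrow> (sqrt q * (1 - w))\<^sup>2 \<le> (1 - \<bar>w\<bar>)\<^sup>2"
    using assms by (subst power2_le_iff_abs_le) (auto simp: abs_mult)
  then show ?thesis using assms by (simp add: berezin_parameters_def power_mult_distrib)
qed

text \<open>With \<open>u = 1 - cnj l * m\<close> the constraint reads \<open>A = q * u^2\<close>
  with \<open>A\<close> and \<open>q\<close> real. As \<open>Re u > 0\<close>, the vanishing of
  \<open>Im (u^2) = 2 * Re u * Im u\<close> forces \<open>u\<close> to be real.\<close>

lemma nkernel_inner_eq_imp_parameter: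
  assumes l: "l \<in> ball 0 1" and m: "m \<in> ball 0 1" and q: "q > 0"
    and eq: "bergman_inner (bergman_nkernel l) (bergman_nkernel m) = of_real q"
  obtains w where "w \<in> berezin_parameters q" "cnj l * m = of_real w"
    "(1 - (cmod l)\<^sup>2) * (1 - (cmod m)\<^sup>2) = q * (1 - w)\<^sup>2"
proof -
  define u where "u = 1 - cnj l * m"
  define A where "A = (1 - (cmod l)\<^sup>2) * (1 - (cmod m)\<^sup>2)"
  have lm: "cmod (cnj l * m) < 1"
    using l m mult_strict_mono[of "cmod l" 1 "cmod m" 1] by (simp add: norm_mult)
  then have u0: "Re u > 0"
    using complex_Re_le_cmod[of "cnj l * m"] unfolding u_def by simp
  have "of_real A / u\<^sup>2 = complex_of_real q"
    using bergman_inner_nkernel[OF l m] eq by (simp add: A_def u_def)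
  moreover have "u \<noteq> 0" using u0 by auto
  ultimately have Au: "of_real A = of_real q * u\<^sup>2" by (simp add: field_simps)
  have "q * (2 * Re u * Im u) = 0"
    using arg_cong[OF Au, of Im] by (auto simp: power2_eq_square)
  then have "Im u = 0" using q u0 by simp
  then have "cnj l * m = of_real (Re (cnj l * m))"
    by (simp add: u_def complex_eq_iff)
  then obtain w where w: "cnj l * m = of_real w" ..
  have "complex_of_real A = of_real (q * (1 - w)\<^sup>2)"
    using Au unfolding u_def w by simp
  then have A: "A = q * (1 - w)\<^sup>2" by (simp only: of_real_eq_iff)
  have abs_w: "\<bar>w\<bar> = cmod l * cmod m"
    using arg_cong[OF w, of cmod] by (simp add: norm_mult)
  \<comment> \<open>The defect in the admissibility inequality is a perfect square, because
    \<open>|w|\<close> is the product of the two moduli.\<close>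
  have "(1 - \<bar>w\<bar>)\<^sup>2 - A = (cmod l - cmod m)\<^sup>2"
    unfolding abs_w A_def by (simp add: power2_eq_square algebra_simps)
  then have "A \<le> (1 - \<bar>w\<bar>)\<^sup>2" using zero_le_power2[of "cmod l - cmod m"] by linarith
  moreover have "\<bar>w\<bar> < 1" using lm unfolding w by simp
  ultimately have "w \<in> berezin_parameters q"
    using berezin_parameters_iff[of q w] q unfolding A by auto
  then show thesis using that w A unfolding A_def by blast
qed

text \<open>Real \<open>l\<close> and \<open>m\<close> suffice. For their squares \<open>a\<close>
  and \<open>b\<close>, prescribing \<open>a * b = w^2\<close> and
  \<open>(1 - a) * (1 - b) = q * (1 - w)^2\<close> fixes \<open>a + b = S\<close>; admissibility of
  \<open>w\<close> makes the discriminant nonnegative.\<close>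

lemma parameter_imp_nkernels:
  assumes q: "q > 0" and w: "w \<in> berezin_parameters q"
  obtains l m where "l \<in> ball 0 1" "m \<in> ball 0 1" "cnj l * m = of_real w"
    "(1 - (cmod l)\<^sup>2) * (1 - (cmod m)\<^sup>2) = q * (1 - w)\<^sup>2"
proof -
  have w1: "-1 < w" "w < 1" using w by (auto simp: berezin_parameters_def)
  have le: "q * (1 - w)\<^sup>2 \<le> (1 - \<bar>w\<bar>)\<^sup>2"
    using w berezin_parameters_iff[of q w] q w1 by simp
  \<comment> \<open>The squared moduli of the two kernel parameters are the roots of \<open>t\<^sup>2 - S t + w\<^sup>2\<close>.\<close>
  define S where "S = 1 + w\<^sup>2 - q * (1 - w)\<^sup>2"
  define a where "a = (S - sqrt (S\<^sup>2 - 4 * w\<^sup>2)) / 2"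
  define b where "b = (S + sqrt (S\<^sup>2 - 4 * w\<^sup>2)) / 2"
  \<comment> \<open>The difference \<open>S - 2 * |w|\<close> equals
    \<open>(1 - |w|)^2 - q * (1 - w)^2\<close>.\<close>
  have S: "S \<ge> 2 * \<bar>w\<bar>"
    using le by (simp add: S_def power2_eq_square algebra_simps)
  have "(2 * \<bar>w\<bar>)\<^sup>2 \<le> S\<^sup>2"
    using S by (intro power_mono) auto
  then have D: "S\<^sup>2 - 4 * w\<^sup>2 \<ge> 0" by (simp add: power_mult_distrib)
  have "sqrt (S\<^sup>2 - 4 * w\<^sup>2) \<le> S"
    using S by (intro real_le_lsqrt) auto
  then have ab0: "0 \<le> a" "0 \<le> b" "a \<le> b" using D S by (auto simp: a_def b_def)
  have "(S - sqrt (S\<^sup>2 - 4 * w\<^sup>2)) * (S + sqrt (S\<^sup>2 - 4 * w\<^sup>2)) = 4 * w\<^sup>2"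
    using D by (simp add: algebra_simps power2_eq_square)
  then have prod: "a * b = w\<^sup>2" by (simp add: a_def b_def)
  have sum: "a + b = S" by (simp add: a_def b_def field_simps)
  have eq: "(1 - a) * (1 - b) = q * (1 - w)\<^sup>2"
    using prod sum by (simp add: S_def algebra_simps)
  have "w\<^sup>2 < 1" using w1 by (simp add: abs_square_less_1)
  \<comment> \<open>Since \<open>(1 - a) * (1 - b)\<close> is positive, \<open>a\<close> and
    \<open>b\<close> lie on the same side of 1; both above 1 would contradict
    \<open>a * b = w^2 < 1\<close>.\<close>
  have "b < 1"
  proof (rule ccontr)
    assume "\<not> b < 1"
    have "(1 - a) * (1 - b) > 0" using eq q w1 by simp
    with \<open>\<not> b < 1\<close> have "1 < a" by (simp add: zero_less_mult_iff)
    then have "1 < a * b" using \<open>\<not> b < 1\<close> less_1_mult[of a b] by (cases "b = 1") auto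
    then show False using prod \<open>w\<^sup>2 < 1\<close> by simp
  qed
  \<comment> \<open>The square roots only recover \<open>|w|\<close>; the sign of \<open>w\<close>
    is put on \<open>m\<close>.\<close>
  define \<sigma> :: real where "\<sigma> = (if w < 0 then -1 else 1)"
  define l where "l = complex_of_real (sqrt a)"
  define m where "m = complex_of_real (\<sigma> * sqrt b)"
  have "sqrt a * sqrt b = \<bar>w\<bar>"
    using prod by (metis real_sqrt_abs real_sqrt_mult)
  then have "sqrt a * (\<sigma> * sqrt b) = w" by (auto simp: \<sigma>_def)
  then have "cnj l * m = of_real w"
    by (simp add: l_def m_def flip: of_real_mult)
  moreover have nl: "(cmod l)\<^sup>2 = a" "(cmod m)\<^sup>2 = b"
    using ab0 by (auto simp: l_def m_def \<sigma>_def norm_mult)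
  moreover have "l \<in> ball 0 1" "m \<in> ball 0 1"
    using ab0 \<open>b < 1\<close> nl abs_square_less_1[of "cmod l"] abs_square_less_1[of "cmod m"] by auto
  ultimately show thesis using that eq by metis
qed

text \<open>The point of the range divided by \<open>q\<close>. The curve passes through 1 at
  \<open>w = 0\<close> and reaches 0 at the excluded endpoint \<open>w = 1\<close>.\<close>

definition berezin_curve :: "complex \<Rightarrow> real \<Rightarrow> complex" where
  "berezin_curve \<zeta> w = of_real ((1 - w)\<^sup>2) / (1 - \<zeta> * of_real w)\<^sup>2"

lemma q_berezin_range_dilation:
  assumes "cmod \<zeta> \<le> 1" and q: "q > 0"
  shows "q_berezin_range (of_real q) (composition_op (\<lambda>z. \<zeta> * z))
    = (\<lambda>w. of_real q * berezin_curve \<zeta> w) ` berezin_parameters q"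
    (is "?L = ?R")
proof (intro equalityI subsetI)
  fix x assume "x \<in> ?L"
  then obtain l m where lm: "l \<in> ball 0 1" "m \<in> ball 0 1"
    and i: "bergman_inner (bergman_nkernel l) (bergman_nkernel m) = of_real q"
    and x: "x = bergman_inner (composition_op ((*) \<zeta>) (bergman_nkernel l)) (bergman_nkernel m)"
    unfolding q_berezin_range_def by blast
  obtain w where "w \<in> berezin_parameters q" "cnj l * m = of_real w"
    "(1 - (cmod l)\<^sup>2) * (1 - (cmod m)\<^sup>2) = q * (1 - w)\<^sup>2"
    using nkernel_inner_eq_imp_parameter[OF lm q i] .
  then show "x \<in> ?R"
    unfolding x composition_op_nkernel[OF lm(1)] bergman_inner_dilated_nkernel[OF lm assms(1)]
    by (auto simp: berezin_curve_def)
next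
  fix x assume "x \<in> ?R"
  then obtain w where w: "w \<in> berezin_parameters q" and x: "x = of_real q * berezin_curve \<zeta> w"
    by blast
  obtain l m where lm: "l \<in> ball 0 1" "m \<in> ball 0 1" and eq: "cnj l * m = of_real w"
    "(1 - (cmod l)\<^sup>2) * (1 - (cmod m)\<^sup>2) = q * (1 - w)\<^sup>2"
    using parameter_imp_nkernels[OF q w] .
  have "bergman_inner (bergman_nkernel l) (bergman_nkernel m)
      = of_real (q * (1 - w)\<^sup>2) / (of_real (1 - w))\<^sup>2"
    unfolding bergman_inner_nkernel[OF lm] eq by simp
  also have "\<dots> = of_real (q * (1 - w)\<^sup>2 / (1 - w)\<^sup>2)"
    by (simp only: of_real_divide of_real_power)
  also have "\<dots> = of_real q"
    using w by (simp add: berezin_parameters_def)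
  finally have "bergman_inner (bergman_nkernel l) (bergman_nkernel m) = of_real q" .
  moreover have "x = bergman_inner (composition_op ((*) \<zeta>) (bergman_nkernel l)) (bergman_nkernel m)"
    unfolding x composition_op_nkernel[OF lm(1)] bergman_inner_dilated_nkernel[OF lm assms(1)] eq
    by (simp add: berezin_curve_def)
  ultimately show "x \<in> ?L"
    unfolding q_berezin_range_def using lm by blast
qed

section \<open>Shape of the parameter set\<close>

lemma is_interval_berezin_parameters:
  assumes "q \<in> {0<..<1}"
  shows "is_interval (berezin_parameters q)"
  unfolding is_interval_1
proof (intro ballI allI impI)
  fix a b x assume ab: "a \<in> berezin_parameters q" "b \<in> berezin_parameters q" and x: "a \<le> x \<and> x \<le> b"
  have s: "0 < sqrt q" "sqrt q < 1" using assms by auto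
  have "sqrt q * (1 - x) \<le> 1 - \<bar>x\<bar>"
  \<comment> \<open>For \<open>x \<ge> 0\<close> the inequality follows from
    \<open>sqrt q < 1\<close>. For \<open>x < 0\<close> it is inherited from \<open>a\<close>:
    moving right from \<open>a\<close> towards 0 lowers the left side and raises the right
    side.\<close>
  proof (cases "x \<ge> 0")
    case True
    then show ?thesis
      using ab x s mult_right_mono[of "sqrt q" 1 "1 - x"] by (simp add: berezin_parameters_def)
  next
    case False
    have "sqrt q * (1 - x) \<le> sqrt q * (1 - a)" using s x by (intro mult_left_mono) auto
    also have "\<dots> \<le> 1 - \<bar>a\<bar>" using ab by (simp add: berezin_parameters_def)
    also have "\<dots> \<le> 1 - \<bar>x\<bar>" using x False by simp
    finally show ?thesis .
  qed
  then show "x \<in> berezin_parameters q" using ab x by (simp add: berezin_parameters_def)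
qed

lemma nonneg_in_berezin_parameters:
  assumes "q \<in> {0<..<1}" "0 \<le> w" "w < 1"
  shows "w \<in> berezin_parameters q"
  using assms mult_right_mono[of "sqrt q" 1 "1 - w"] by (simp add: berezin_parameters_def)

lemma berezin_parameters_negative:
  assumes "q \<in> {0<..<1}"
  obtains w where "w \<in> berezin_parameters q" "w < 0"
proof -
  let ?s = "sqrt q"
  have s: "0 < ?s" "?s < 1" using assms by auto
  have p: "1 + ?s > 0" using s by linarith
  \<comment> \<open>The point \<open>- r\<close> is the left endpoint, where the defining inequality
    is an equality.\<close>
  define r where "r = (1 - ?s) / (1 + ?s)"
  have "r > 0" unfolding r_def using s p by (intro divide_pos_pos) auto
  moreover have "r < 1" unfolding r_def using s p by (subst pos_divide_less_eq) auto
  moreover have "?s * (1 + r) = 1 - r" unfolding r_def using p by (simp add: field_simps)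
  ultimately have "- r \<in> berezin_parameters q" "- r < 0"
    by (simp_all add: berezin_parameters_def)
  then show thesis by (rule that)
qed

section \<open>Convexity for real \<open>\<zeta>\<close> and its failure for non-real
  \<open>\<zeta>\<close>\<close>

lemma convex_berezin_range_real:
  assumes x: "\<bar>x\<bar> \<le> 1" and q: "q \<in> {0<..<1}"
  shows "convex ((\<lambda>w. of_real q * berezin_curve (of_real x) w) ` berezin_parameters q)"
proof -
  define f where "f = (\<lambda>w. q * ((1 - w)\<^sup>2 / (1 - x * w)\<^sup>2))"
  have nz: "1 - x * w \<noteq> 0" if "w \<in> berezin_parameters q" for w
  proof
    assume "1 - x * w = 0"
    moreover have "\<bar>x\<bar> * \<bar>w\<bar> \<le> 1 * \<bar>w\<bar>" using x by (intro mult_right_mono) auto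
    moreover have "\<bar>w\<bar> < 1" using that by (auto simp: berezin_parameters_def)
    ultimately show False using abs_mult[of x w] by simp
  qed
  have "continuous_on (berezin_parameters q) f"
    unfolding f_def by (intro continuous_intros) (use nz in auto)
  moreover have "connected (berezin_parameters q)"
    using is_interval_berezin_parameters[OF q] is_interval_connected_1 by blast
  \<comment> \<open>On the real line connected sets are convex, and the linear embedding into the
    complex plane preserves convexity.\<close>
  ultimately have "convex (f ` berezin_parameters q)"
    using connected_continuous_image is_interval_connected_1 is_interval_convex_1 by blast
  then have "convex (complex_of_real ` f ` berezin_parameters q)"
    by (rule convex_linear_image[OF bounded_linear.linear[OF bounded_linear_of_real]])
  also have "complex_of_real ` f ` berezin_parameters q
      = (\<lambda>w. of_real q * berezin_curve (of_real x) w) ` berezin_parameters q"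
    by (simp add: image_image f_def berezin_curve_def)
  finally show ?thesis .
qed

text \<open>With \<open>u = 1 - \<zeta> * w\<close>, the curve is a positive multiple of
  \<open>(cnj u)^2\<close>, whose imaginary part is \<open>2 * Re u * Im \<zeta> * w\<close> with
  \<open>Re u > 0\<close>. The product form covers all sign combinations of \<open>w\<close> and
  \<open>Im \<zeta>\<close> at once.\<close>

lemma Im_berezin_curve_sign:
  assumes z: "cmod \<zeta> \<le> 1" "Im \<zeta> \<noteq> 0" and w: "-1 < w" "w < 1" "w \<noteq> 0"
  shows "w * Im \<zeta> * Im (berezin_curve \<zeta> w) > 0"
proof -
  define u where "u = 1 - \<zeta> * of_real w"
  have "\<bar>Re \<zeta> * w\<bar> < 1"
  proof -
    have "\<bar>Re \<zeta>\<bar> * \<bar>w\<bar> \<le> 1 * \<bar>w\<bar>"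
      using abs_Re_le_cmod[of \<zeta>] z by (intro mult_right_mono) auto
    moreover have "\<bar>w\<bar> < 1" using w by linarith
    ultimately show ?thesis unfolding abs_mult by linarith
  qed
  then have Re: "Re u > 0" by (auto simp: u_def)
  have Im: "Im u = - (Im \<zeta> * w)" by (simp add: u_def)
  have "u \<noteq> 0" using Re by auto
  have "berezin_curve \<zeta> w = of_real ((1 - w)\<^sup>2 / (cmod u ^ 2)\<^sup>2) * (cnj u)\<^sup>2"
  proof -
    have "complex_of_real ((cmod u ^ 2)\<^sup>2) = (u * cnj u)\<^sup>2"
      unfolding complex_norm_square [symmetric] by (rule of_real_power)
    then show ?thesis
      unfolding berezin_curve_def u_def [symmetric] of_real_divide
      using \<open>u \<noteq> 0\<close> by (simp add: power_mult_distrib)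
  qed
  then have "Im (berezin_curve \<zeta> w) = (1 - w)\<^sup>2 / (cmod u ^ 2)\<^sup>2 * Im ((cnj u)\<^sup>2)"
    by (simp only: Im_complex_of_real Re_complex_of_real times_complex.sel)
  also have "Im ((cnj u)\<^sup>2) = 2 * Re u * (Im \<zeta> * w)"
    using Im by (simp add: power2_eq_square)
  finally have "w * Im \<zeta> * Im (berezin_curve \<zeta> w)
      = (1 - w)\<^sup>2 / (cmod u ^ 2)\<^sup>2 * (2 * Re u) * (Im \<zeta> * w)\<^sup>2"
    by (simp add: power2_eq_square)
  also have "\<dots> > 0" using w Re z \<open>u \<noteq> 0\<close> by (intro mult_pos_pos divide_pos_pos) auto
  finally show ?thesis .
qed

lemma not_convex_berezin_range_nonreal:
  assumes z: "cmod \<zeta> \<le> 1" "Im \<zeta> \<noteq> 0" and q: "q \<in> {0<..<1}"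
  shows "\<not> convex ((\<lambda>w. of_real q * berezin_curve \<zeta> w) ` berezin_parameters q)" (is "\<not> convex ?E")
proof
  assume E: "convex ?E"
  define F where "F = (\<lambda>w. of_real q * berezin_curve \<zeta> w)"
  have sgn: "w * Im \<zeta> * Im (F w) > 0" if "-1 < w" "w < 1" "w \<noteq> 0" for w
    using Im_berezin_curve_sign[OF z that] q by (simp add: F_def mult.left_commute)
  have real: "x = of_real q" if "x \<in> ?E" "Im x = 0" for x
  proof -
    from that(1) obtain w where w: "w \<in> berezin_parameters q" "x = F w" unfolding F_def by blast
    then have "w = 0" using sgn[of w] that(2) by (cases "w = 0") (auto simp: berezin_parameters_def)
    then show ?thesis using w by (simp add: F_def berezin_curve_def)
  qed
  obtain v where v: "v \<in> berezin_parameters q" "v < 0" using berezin_parameters_negative[OF q] .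
  \<comment> \<open>\<open>h w = 0\<close> expresses that \<open>F v\<close>, \<open>F w\<close> and \<open>q\<close> are collinear.\<close>
  define h where "h = (\<lambda>w. Im (F w) * Re (F v) - Im (F v) * Re (F w) - q * (Im (F w) - Im (F v)))"
  have h0: "h w = 0" if w: "0 < w" "w < 1" for w
  proof -
    have "v * Im \<zeta> * Im (F v) > 0" "w * Im \<zeta> * Im (F w) > 0"
      using sgn[of v] sgn[of w] v w by (auto simp: berezin_parameters_def)
    then have opp: "Im (F v) < 0 \<and> 0 < Im (F w) \<or> Im (F w) < 0 \<and> 0 < Im (F v)"
      using v w by (auto simp: zero_less_mult_iff mult_less_0_iff)
    \<comment> \<open>The weights \<open>t\<close> and \<open>s\<close> locate the crossing of the
      chord from \<open>F v\<close> to \<open>F w\<close> with the real axis; opposite signs of the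
      imaginary parts make them nonnegative.\<close>
    define t where "t = Im (F w) / (Im (F w) - Im (F v))"
    define s where "s = - Im (F v) / (Im (F w) - Im (F v))"
    have st: "0 \<le> t" "0 \<le> s" "t + s = 1"
      using opp by (auto simp: t_def s_def field_simps zero_le_divide_iff divide_le_0_iff)
    have "F v \<in> ?E" "F w \<in> ?E"
      using v nonneg_in_berezin_parameters[OF q, of w] w by (auto simp: F_def)
    then have "t *\<^sub>R F v + s *\<^sub>R F w \<in> ?E" by (rule convexD[OF E]) (use st in auto)
    moreover have "Im (t *\<^sub>R F v + s *\<^sub>R F w) = 0"
      using opp by (auto simp: t_def s_def field_simps)
    ultimately have "t *\<^sub>R F v + s *\<^sub>R F w = of_real q" by (rule real)
    from arg_cong[OF this, of Re] have "t * Re (F v) + s * Re (F w) = q" by simp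
    then show ?thesis using opp by (auto simp: t_def s_def h_def field_simps)
  qed
  \<comment> \<open>The value \<open>w = 1\<close> is not a parameter, but the denominator
    \<open>1 - \<zeta>\<close> does not vanish there, so \<open>h\<close> is continuous at 1 and its
    zeros on \<open>(0, 1)\<close> force \<open>h 1 = 0\<close>.\<close>
  have "\<zeta> \<noteq> 1" using z by auto
  then have "isCont h 1"
    unfolding h_def F_def berezin_curve_def by (intro continuous_intros) auto
  then have "(h \<longlongrightarrow> h 1) (at_left 1)"
    by (simp add: isCont_def filterlim_at_split)
  moreover have "eventually (\<lambda>w. h w = 0) (at_left 1)"
    using eventually_at_left_real[OF zero_less_one] by (rule eventually_mono) (auto intro: h0)
  ultimately have "((\<lambda>_. 0) \<longlongrightarrow> h 1) (at_left (1::real))"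
    by (rule Lim_transform_eventually)
  then have "h 1 = 0" by (simp add: tendsto_const_iff)
  \<comment> \<open>Since \<open>F 1 = 0\<close>, the value \<open>h 1\<close> reduces to
    \<open>q * Im (F v)\<close>.\<close>
  then have "Im (F v) = 0" using q by (simp add: h_def F_def berezin_curve_def)
  then show False using sgn[of v] v by (auto simp: berezin_parameters_def)
qed

theorem theorem3p8:
  fixes \<zeta> :: complex and q :: real
  assumes "\<zeta> \<in> cball 0 1" and "q \<in> {0<..<1}"
  shows "convex (q_berezin_range (of_real q) (composition_op (\<lambda>z. \<zeta> * z)))
           \<longleftrightarrow> \<zeta> \<in> complex_of_real ` {-1..1}"
proof -
  have z: "cmod \<zeta> \<le> 1" and q: "q > 0" using assms by auto
  have range: "q_berezin_range (of_real q) (composition_op (\<lambda>z. \<zeta> * z))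
      = (\<lambda>w. of_real q * berezin_curve \<zeta> w) ` berezin_parameters q"
    by (rule q_berezin_range_dilation[OF z q])
  show ?thesis
  proof
    assume "convex (q_berezin_range (of_real q) (composition_op (\<lambda>z. \<zeta> * z)))"
    then have "Im \<zeta> = 0"
      using not_convex_berezin_range_nonreal[OF z _ assms(2)] unfolding range by blast
    then have "\<zeta> = of_real (Re \<zeta>)" by (simp add: complex_eq_iff)
    moreover have "Re \<zeta> \<in> {-1..1}" using abs_Re_le_cmod[of \<zeta>] z by auto
    ultimately show "\<zeta> \<in> complex_of_real ` {-1..1}" by blast
  next
    assume "\<zeta> \<in> complex_of_real ` {-1..1}"
    then show "convex (q_berezin_range (of_real q) (composition_op (\<lambda>z. \<zeta> * z)))"
      using convex_berezin_range_real[OF _ assms(2)] unfolding range by auto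
  qed
qed

end
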